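(* Let $G$ be a finite abelian group. The endomorphism graph of $G$ is complete if and only if $G\cong(\mathbb{Z}_{p^a})^m\times(\mathbb{Z}_{p^{a+1}})^n$ for some prime $p$ and some integers $m,n\ge 0$, $a\ge 1$.
   Context: The endomorphism graph of a group $G$ is the simple undirected graph with vertex set $G$ in which distinct $x,y$ are adjacent if and only if some endomorphism of $G$ maps $x$ to $y$ or maps $y$ to $x$. $\mathbb{Z}_k$ is the cyclic group of order $k$. *)

theory Defs
  imports
    "HOL-Computational_Algebra.Primes"
    "HOL-Algebra.Product_Groups"
    "Graph_Theory.Kuratowski"
begin

text \<open>Simple undirected graphs are loop-free symmetric digraphs without parallel arcs,
  following the convention of \<open>Graph_Theory\<close>.\<close>

definition endomorphism_graph :: "('a, 'b) monoid_scheme \<Rightarrow> 'a pair_pre_digraph" where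
  "endomorphism_graph G =
    \<lparr> pverts = carrier G,
      parcs = {(x, y). x \<in> carrier G \<and> y \<in> carrier G \<and> x \<noteq> y \<and>
        (\<exists>f \<in> hom G G. f x = y \<or> f y = x)} \<rparr>"

lemma pair_graph_endomorphism_graph:
  assumes "finite (carrier G)"
  shows "pair_graph (endomorphism_graph G)"
proof
  have "parcs (endomorphism_graph G) \<subseteq> carrier G \<times> carrier G"
    by (auto simp: endomorphism_graph_def)
  then show "finite (parcs (endomorphism_graph G))"
    using assms finite_subset by blast
qed (use assms in \<open>auto simp: endomorphism_graph_def symmetric_def sym_def\<close>)

text \<open>The graph \<open>\<Gamma>\<close> is complete iff it is the complete graph on its own number of vertices.\<close>

definition complete_graph :: "('v, 'e) pre_digraph \<Rightarrow> bool" where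
  "complete_graph \<Gamma> \<longleftrightarrow> complete_digraph (card (verts \<Gamma>)) \<Gamma>"

text \<open>The direct power \<open>(\<int>\<^sub>k)\<^sup>m\<close>; for \<open>m = 0\<close> it is the trivial group.
  Caution: \<open>integer_mod_group 0\<close> is the infinite cyclic group.\<close>

abbreviation cyclic_power :: "nat \<Rightarrow> nat \<Rightarrow> (nat \<Rightarrow> int) monoid" where
  "cyclic_power k m \<equiv> product_group {..<m} (\<lambda>_. integer_mod_group k)"

end

theory Submission
  imports Defs "HOL-Algebra.Multiplicative_Group"
begin

text \<open>Say that \<open>y\<close> lies below \<open>x\<close> if some endomorphism maps \<open>x\<close> to \<open>y\<close>.  The graph is complete iff this
preorder is total (\<open>endomorphism_chain\<close>), and totality is invariant under isomorphism.

In \<open>P = (\<int>/p\<^sup>a)\<^sup>m \<times> (\<int>/p\<^sup>a\<^sup>+\<^sup>1)\<^sup>n\<close> the subgroups that can be described by divisibility of the two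
kinds of coordinates and are invariant under endomorphisms form a single descending chain
\<open>P = S\<^sub>0 \<supseteq> S\<^sub>1 \<supseteq> S\<^sub>2 \<supseteq> \<dots>\<close>, namely \<open>p\<^sup>h \<times> p\<^sup>h\<close>, \<open>p\<^sup>h \<times> p\<^sup>h\<^sup>+\<^sup>1\<close>, \<open>p\<^sup>h\<^sup>+\<^sup>1 \<times> p\<^sup>h\<^sup>+\<^sup>1\<close>, and so on.  An element outside
\<open>S\<^bsub>t+1\<^esub>\<close> has a coordinate of small \<open>p\<close>-adic valuation, and multiplying that one coordinate by
suitable integers already reaches every element of \<open>S\<^bsub>t\<^esub>\<close> (\<open>endomorphism_into_layer\<close>).  So of two
elements, the one that leaves the chain first can be mapped to the other.

Conversely, let the preorder on a finite abelian group \<open>G\<close> be total.  Elements of coprime orders are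
incomparable unless one is trivial, so \<open>G\<close> is a \<open>p\<close>-group.  Let \<open>p\<^sup>a\<^sup>+\<^sup>1\<close> be its exponent and let \<open>x\<close>
have maximal order; for exponent \<open>1\<close> or \<open>p\<close> put \<open>a = 1\<close>.  Every element \<open>y\<close> killed by \<open>p\<^sup>a\<^sup>-\<^sup>1\<close> is a
\<open>p\<close>-th power (\<open>endomorphism_chain_imp_roots\<close>): for \<open>a = 1\<close> it is trivial, and otherwise its order is
too small for it to be mapped to \<open>x\<^sup>p\<close>, so it is an image of \<open>x\<^sup>p\<close>.
Thus an element that is not a \<open>p\<close>-th power, such as a generator of
a nontrivial cyclic direct factor, has order \<open>p\<^sup>a\<close> or \<open>p\<^sup>a\<^sup>+\<^sup>1\<close>.  This condition passes to direct factors, and a cyclic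
subgroup of maximal order is a direct factor (\<open>maximal_order_cyclic_complement\<close>), so splitting off
such subgroups one after the other yields the decomposition (\<open>two_exponents_decomposition\<close>).\<close>

section \<open>The endomorphism preorder\<close>

definition endomorphism_chain :: "('a, 'b) monoid_scheme \<Rightarrow> bool" where
  "endomorphism_chain G \<longleftrightarrow>
    (\<forall>x \<in> carrier G. \<forall>y \<in> carrier G. \<exists>f \<in> hom G G. f x = y \<or> f y = x)"

lemma complete_endomorphism_graph_iff:
  assumes "finite (carrier G)"
  shows "complete_graph (with_proj (endomorphism_graph G)) \<longleftrightarrow> endomorphism_chain G"
proof -
  have id: "\<exists>f \<in> hom G G. f x = x" for x
    by (rule bexI[of _ "\<lambda>x. x"]) (auto simp: hom_def)
  have "complete_graph (with_proj (endomorphism_graph G)) \<longleftrightarrow>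
    (\<forall>x \<in> carrier G. \<forall>y \<in> carrier G. x \<noteq> y \<longrightarrow> (\<exists>f \<in> hom G G. f x = y \<or> f y = x))"
    using assms
    unfolding complete_graph_def complete_digraph_pair_def endomorphism_graph_def
    by (simp add: set_eq_iff) blast
  also have "\<dots> \<longleftrightarrow> endomorphism_chain G"
    unfolding endomorphism_chain_def
  proof (intro ball_cong refl)
    fix x y
    show "(x \<noteq> y \<longrightarrow> (\<exists>f \<in> hom G G. f x = y \<or> f y = x)) \<longleftrightarrow> (\<exists>f \<in> hom G G. f x = y \<or> f y = x)"
      using id[of x] by (cases "x = y") auto
  qed
  finally show ?thesis .
qed

lemma endomorphism_chain_iso:
  assumes "G \<cong> H" "group G" "endomorphism_chain H"
  shows "endomorphism_chain G"
proof -
  interpret group G by fact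
  obtain \<phi> where \<phi>: "\<phi> \<in> iso G H"
    using assms(1) by (auto simp: is_iso_def)
  define \<psi> where "\<psi> = inv_into (carrier G) \<phi>"
  have hom: "\<phi> \<in> hom G H" "\<psi> \<in> hom H G"
    using \<phi> iso_set_sym[OF \<phi>] by (auto simp: iso_def \<psi>_def)
  have inverse: "\<psi> (\<phi> x) = x" if "x \<in> carrier G" for x
    using \<phi> that by (auto simp: iso_def bij_betw_def \<psi>_def)
  show ?thesis
    unfolding endomorphism_chain_def
  proof (intro ballI)
    fix x y assume xy: "x \<in> carrier G" "y \<in> carrier G"
    then obtain f where f: "f \<in> hom H H" "f (\<phi> x) = \<phi> y \<or> f (\<phi> y) = \<phi> x"
      using assms(3) hom(1) unfolding endomorphism_chain_def by (meson hom_in_carrier)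
    have "\<psi> \<circ> (f \<circ> \<phi>) \<in> hom G G"
      using hom f(1) by (intro Group.hom_compose)
    then show "\<exists>f \<in> hom G G. f x = y \<or> f y = x"
      using f(2) inverse xy by (intro bexI[of _ "\<psi> \<circ> (f \<circ> \<phi>)"]) auto
  qed
qed

section \<open>Homomorphisms between products of cyclic groups\<close>

text \<open>Write \<open>u = p\<^sup>i w\<close> with \<open>w\<close> prime to \<open>p\<close>; then \<open>i \<le> h\<close>, so \<open>p\<^sup>i\<close> divides \<open>y\<close>, and \<open>w\<close> is invertible modulo
\<open>p\<^sup>b\<close>.\<close>

lemma prime_power_cong_solution:
  fixes p :: nat and u y :: int
  assumes p: "Factorial_Ring.prime p" and u: "\<not> int p ^ Suc h dvd u" and y: "int p ^ h dvd y"
  shows "\<exists>c. int p ^ b dvd c * u - y"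
proof -
  have P: "Factorial_Ring.prime (int p)" using p by simp
  have u0: "u \<noteq> 0" using u by auto
  define i where "i = multiplicity (int p) u"
  have np: "\<not> is_unit (int p)" using P not_prime_unit by blast
  obtain w where w: "u = int p ^ i * w" "\<not> int p dvd w"
    using multiplicity_decompose'[OF u0 np] unfolding i_def by blast
  have "i \<le> h"
    using u multiplicity_dvd'[of "Suc h" "int p" u] unfolding i_def by force
  then obtain z where z: "y = int p ^ i * z"
    using y le_imp_power_dvd dvd_trans unfolding dvd_def by metis
  have "coprime w (int p ^ b)"
    using prime_imp_coprime[OF P w(2)] by (simp add: coprime_commute)
  then obtain s t where "s * w + t * int p ^ b = 1"
    using bezout_int[of w "int p ^ b"] by (metis coprime_imp_gcd_eq_1)
  then have sw: "s * w = 1 - t * int p ^ b" by simp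
  have "(z * s) * u - y = int p ^ i * z * (s * w - 1)"
    unfolding w(1) z by (simp add: algebra_simps)
  also have "\<dots> = int p ^ b * (- (int p ^ i * z * t))"
    unfolding sw by simp
  finally have "(z * s) * u - y = int p ^ b * (- (int p ^ i * z * t))" .
  then show ?thesis by (metis dvd_triv_left)
qed

lemma hom_integer_mod_group_mult:
  assumes "r > 0" "q > 0" "int r dvd c * int q"
  shows "(\<lambda>u. (c * u) mod int r) \<in> hom (integer_mod_group q) (integer_mod_group r)"
proof (rule homI)
  fix x y assume "x \<in> carrier (integer_mod_group q)" "y \<in> carrier (integer_mod_group q)"
  have "c * ((x + y) mod int q) = c * (x + y) - c * int q * ((x + y) div int q)"
    by (simp add: minus_mult_div_eq_mod[symmetric] algebra_simps)
  then have "c * ((x + y) mod int q) - (c * x + c * y) = - (c * int q * ((x + y) div int q))"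
    by (simp add: algebra_simps)
  then have "(c * ((x + y) mod int q)) mod int r = (c * x + c * y) mod int r"
    using assms(3) by (simp add: mod_eq_dvd_iff)
  then show "c * (x \<otimes>\<^bsub>integer_mod_group q\<^esub> y) mod int r
      = (c * x mod int r) \<otimes>\<^bsub>integer_mod_group r\<^esub> (c * y mod int r)"
    by (simp add: mod_add_eq)
qed (use assms in \<open>auto simp: carrier_integer_mod_group\<close>)

text \<open>The map is multiplication by an integer \<open>k\<close>.  It must be well defined modulo \<open>p\<^sup>b\<close>, which costs a
factor \<open>p\<^sup>d\<close> in \<open>k\<close> when the target has up to \<open>d\<close> more powers of \<open>p\<close> than the source; this is why \<open>y\<close> has to
be divisible by \<open>p\<^sup>d\<close> beyond the valuation bound \<open>h\<close> of \<open>u\<close>.\<close>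

lemma hom_between_prime_power_cyclic:
  fixes p :: nat and u y :: int
  assumes p: "Factorial_Ring.prime p" and bc: "c \<le> b + d"
    and u: "\<not> int p ^ Suc h dvd u" and y: "int p ^ (h + d) dvd y"
    and yc: "y \<in> carrier (integer_mod_group (p ^ c))"
  shows "\<exists>f \<in> hom (integer_mod_group (p ^ b)) (integer_mod_group (p ^ c)). f u = y"
proof -
  have p0: "p > 0" using p by (rule prime_gt_0_nat)
  obtain z where z: "y = int p ^ h * int p ^ d * z"
    using y by (auto simp: power_add)
  obtain e where e: "int p ^ c dvd e * u - int p ^ h * z"
    using prime_power_cong_solution[OF p u, of "int p ^ h * z" c] by auto
  define k where "k = int p ^ d * e"
  have "k * u - y = int p ^ d * (e * u - int p ^ h * z)"
    unfolding k_def z by (simp add: algebra_simps)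
  then have "int p ^ c dvd k * u - y"
    using e by simp
  then have "(k * u) mod int (p ^ c) = y"
    using yc p0 by (simp add: carrier_integer_mod_group mod_eq_dvd_iff[symmetric])
  moreover have "int (p ^ c) dvd k * int (p ^ b)"
  proof -
    have "int p ^ c dvd int p ^ (b + d)" using bc by (rule le_imp_power_dvd)
    then show ?thesis by (simp add: k_def power_add mult.commute mult.left_commute)
  qed
  ultimately show ?thesis
    using hom_integer_mod_group_mult[of "p ^ c" "p ^ b" k] p0 by force
qed

lemma hom_into_product_group:
  assumes "\<And>i. i \<in> I \<Longrightarrow> f i \<in> hom A (G i)"
  shows "(\<lambda>x. \<lambda>i\<in>I. f i x) \<in> hom A (product_group I G)"
  using assms by (auto simp: hom_def Pi_iff)

lemma hom_product_group_component:
  assumes "i \<in> I"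
  shows "(\<lambda>x. x i) \<in> hom (product_group I G) (G i)"
  using assms by (auto simp: hom_def)

lemma fst_hom: "fst \<in> hom (G \<times>\<times> H) G"
  and snd_hom: "snd \<in> hom (G \<times>\<times> H) H"
  by (auto simp: hom_def)

text \<open>All coordinates of the target are produced from the single value \<open>\<pi> x\<close>, each by its own
homomorphism of cyclic groups.\<close>

lemma hom_through_component:
  fixes p :: nat
  assumes p: "Factorial_Ring.prime p"
    and \<pi>: "\<pi> \<in> hom A (integer_mod_group (p ^ b))" "\<not> int p ^ Suc h dvd \<pi> x"
    and y: "y \<in> carrier (cyclic_power (p ^ c) m)" "\<And>i. i < m \<Longrightarrow> int p ^ (h + d) dvd y i"
    and c: "c \<le> b + d"
  shows "\<exists>f \<in> hom A (cyclic_power (p ^ c) m). f x = y"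
proof -
  have "\<exists>g \<in> hom (integer_mod_group (p ^ b)) (integer_mod_group (p ^ c)). g (\<pi> x) = y i"
    if "i < m" for i
    using that y by (intro hom_between_prime_power_cyclic[OF p c \<pi>(2)]) auto
  then obtain g where g: "\<And>i. i < m \<Longrightarrow>
      g i \<in> hom (integer_mod_group (p ^ b)) (integer_mod_group (p ^ c)) \<and> g i (\<pi> x) = y i"
    by metis
  have "(\<lambda>z. \<lambda>i\<in>{..<m}. (g i \<circ> \<pi>) z) \<in> hom A (cyclic_power (p ^ c) m)"
    using g \<pi>(1) by (intro hom_into_product_group) (blast intro: Group.hom_compose)
  moreover have "(\<lambda>i\<in>{..<m}. (g i \<circ> \<pi>) x) = y"
    using g y(1) by (auto simp: fun_eq_iff PiE_iff extensional_def)
  ultimately show ?thesis by (intro bexI)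
qed

section \<open>The chain of layers in a product with two adjacent exponents\<close>

text \<open>The \<open>t\<close>-th member of the chain \<open>p\<^sup>h \<times> p\<^sup>h\<close>, \<open>p\<^sup>h \<times> p\<^sup>h\<^sup>+\<^sup>1\<close> of subgroups: \<open>t = 2 h\<close> gives the former,
\<open>t = 2 h + 1\<close> the latter.\<close>

definition divisibility_layer :: "nat \<Rightarrow> nat \<Rightarrow> nat \<Rightarrow> nat \<Rightarrow> ((nat \<Rightarrow> int) \<times> (nat \<Rightarrow> int)) set" where
  "divisibility_layer p m n t =
    {(u, v). (\<forall>i<m. int p ^ (t div 2) dvd u i) \<and> (\<forall>i<n. int p ^ (Suc t div 2) dvd v i)}"

text \<open>Since \<open>x\<close> violates a divisibility condition of layer \<open>t + 1\<close>, it has a coordinate of valuation at most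
some \<open>h\<close>, and layer \<open>t\<close> forces on \<open>y\<close> exactly the divisibility that homomorphisms out of this
coordinate require: \<open>p\<^sup>h\<close> in general, and \<open>p\<^sup>h\<^sup>+\<^sup>1\<close> for homomorphisms from \<open>\<int>/p\<^sup>a\<close> to \<open>\<int>/p\<^sup>a\<^sup>+\<^sup>1\<close>.\<close>

lemma endomorphism_into_layer:
  fixes p a m n :: nat
  defines "P \<equiv> cyclic_power (p ^ a) m \<times>\<times> cyclic_power (p ^ (a + 1)) n"
  assumes p: "Factorial_Ring.prime p"
    and x: "x \<notin> divisibility_layer p m n (Suc t)"
    and y: "y \<in> carrier P" "y \<in> divisibility_layer p m n t"
  shows "\<exists>f \<in> hom P P. f x = y"
proof -
  obtain u v where xuv: "x = (u, v)" by force
  obtain u' v' where yuv: "y = (u', v')" by force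
  have y': "u' \<in> carrier (cyclic_power (p ^ a) m)" "v' \<in> carrier (cyclic_power (p ^ (a + 1)) n)"
    using y(1) by (auto simp: P_def yuv)
  have ydvd: "i < m \<Longrightarrow> int p ^ (t div 2) dvd u' i" "i < n \<Longrightarrow> int p ^ (Suc t div 2) dvd v' i" for i
    using y(2) by (auto simp: divisibility_layer_def yuv)
  have pair: "\<exists>f \<in> hom P P. f x = y"
    if "\<exists>f \<in> hom P (cyclic_power (p ^ a) m). f x = u'"
      "\<exists>f \<in> hom P (cyclic_power (p ^ (a + 1)) n). f x = v'"
  proof -
    obtain f g where "f \<in> hom P (cyclic_power (p ^ a) m)" "f x = u'"
      "g \<in> hom P (cyclic_power (p ^ (a + 1)) n)" "g x = v'"
      using \<open>\<exists>f \<in> hom P (cyclic_power (p ^ a) m). f x = u'\<close>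
        \<open>\<exists>f \<in> hom P (cyclic_power (p ^ (a + 1)) n). f x = v'\<close> by blast
    then have "(\<lambda>z. (f z, g z)) \<in> hom P P" "(f x, g x) = y"
      by (simp_all add: hom_paired P_def yuv)
    then show ?thesis by (intro bexI)
  qed
  have "Suc (Suc t) div 2 = Suc (t div 2)" by simp
  then consider (U) j where "j < m" "\<not> int p ^ (Suc t div 2) dvd u j"
    | (V) j where "j < n" "\<not> int p ^ Suc (t div 2) dvd v j"
    using x unfolding divisibility_layer_def xuv mem_Collect_eq case_prod_conv by metis
  then show ?thesis
  proof cases
    case U
    obtain h where h: "Suc t div 2 = Suc h"
      using U(2) by (cases "Suc t div 2") auto
    have "h \<le> t div 2" using h by linarith
    have \<pi>: "(\<lambda>z. fst z j) \<in> hom P (integer_mod_group (p ^ a))"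
    proof -
      have "fst \<in> hom P (cyclic_power (p ^ a) m)"
        unfolding P_def by (rule fst_hom)
      from Group.hom_compose[OF this hom_product_group_component[of j]] U(1) show ?thesis
        by (simp add: o_def)
    qed
    have nd: "\<not> int p ^ Suc h dvd (\<lambda>z. fst z j) x"
      using U(2) h by (simp add: xuv)
    have "int p ^ (h + 0) dvd u' i" if "i < m" for i
      using ydvd(1)[OF that] le_imp_power_dvd[OF \<open>h \<le> t div 2\<close>] by (metis add_0_right dvd_trans)
    moreover have "int p ^ (h + 1) dvd v' i" if "i < n" for i
      using ydvd(2)[OF that] h by simp
    ultimately show ?thesis
      by (intro pair hom_through_component[where d = 0, OF p \<pi> nd y'(1)]
          hom_through_component[where d = 1, OF p \<pi> nd y'(2)])
        simp_all
  next
    case V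
    have le: "t div 2 \<le> Suc t div 2" by linarith
    have \<pi>: "(\<lambda>z. snd z j) \<in> hom P (integer_mod_group (p ^ (a + 1)))"
    proof -
      have "snd \<in> hom P (cyclic_power (p ^ (a + 1)) n)"
        unfolding P_def by (rule snd_hom)
      from Group.hom_compose[OF this hom_product_group_component[of j]] V(1) show ?thesis
        by (simp add: o_def)
    qed
    have nd: "\<not> int p ^ Suc (t div 2) dvd (\<lambda>z. snd z j) x"
      using V(2) by (simp add: xuv)
    have "int p ^ (t div 2 + 0) dvd u' i" if "i < m" for i
      using ydvd(1)[OF that] by simp
    moreover have "int p ^ (t div 2 + 0) dvd v' i" if "i < n" for i
      using ydvd(2)[OF that] le_imp_power_dvd[OF le] by (metis add_0_right dvd_trans)
    ultimately show ?thesis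
      by (intro pair hom_through_component[where d = 0, OF p \<pi> nd y'(1)]
          hom_through_component[where d = 0, OF p \<pi> nd y'(2)])
        simp_all
  qed
qed

text \<open>All coordinates are representatives below \<open>p\<^sup>a\<^sup>+\<^sup>1\<close>, so deep layers contain only zero.\<close>

lemma zero_or_outside_some_layer:
  fixes p a m n :: nat
  defines "P \<equiv> cyclic_power (p ^ a) m \<times>\<times> cyclic_power (p ^ (a + 1)) n"
  assumes p: "Factorial_Ring.prime p" and x: "x \<in> carrier P"
  shows "x = \<one>\<^bsub>P\<^esub> \<or> (\<exists>t. x \<notin> divisibility_layer p m n t)"
proof (rule disjCI)
  assume all: "\<nexists>t. x \<notin> divisibility_layer p m n t"
  have p0: "p > 0" using p by (rule prime_gt_0_nat)
  obtain u v where xuv: "x = (u, v)" by force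
  have "x \<in> divisibility_layer p m n (2 * (a + 1))" using all by blast
  then have dvd: "i < m \<Longrightarrow> int p ^ (a + 1) dvd u i" "i < n \<Longrightarrow> int p ^ (a + 1) dvd v i" for i
    by (auto simp: divisibility_layer_def xuv)
  have car: "u \<in> {..<m} \<rightarrow>\<^sub>E {0..<int p ^ a}" "v \<in> {..<n} \<rightarrow>\<^sub>E {0..<int p ^ (a + 1)}"
    using x p0 by (auto simp: P_def xuv carrier_integer_mod_group)
  have "u i = 0" if "i < m" for i
  proof -
    have "int p ^ a dvd u i" using dvd(1)[OF that] by (simp add: dvd_mult_right)
    moreover have "u i \<in> {0..<int p ^ a}" using PiE_mem[OF car(1)] that by simp
    ultimately show ?thesis by (metis atLeastLessThan_iff dvd_imp_mod_0 mod_pos_pos_trivial)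
  qed
  moreover have "v i = 0" if "i < n" for i
  proof -
    have "v i \<in> {0..<int p ^ (a + 1)}" using PiE_mem[OF car(2)] that by simp
    then show ?thesis using dvd(2)[OF that]
      by (metis atLeastLessThan_iff dvd_imp_mod_0 mod_pos_pos_trivial)
  qed
  ultimately have "u = (\<lambda>i\<in>{..<m}. 0)" "v = (\<lambda>i\<in>{..<n}. 0)"
    using car by (auto simp: fun_eq_iff PiE_iff extensional_def)
  then show "x = \<one>\<^bsub>P\<^esub>"
    by (simp add: P_def xuv DirProd_def)
qed

lemma endomorphism_chain_two_exponents:
  fixes p a m n :: nat
  assumes p: "Factorial_Ring.prime p"
  shows "endomorphism_chain (cyclic_power (p ^ a) m \<times>\<times> cyclic_power (p ^ (a + 1)) n)"
    (is "endomorphism_chain ?P")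
  unfolding endomorphism_chain_def
proof (intro ballI)
  fix x y assume x: "x \<in> carrier ?P" and y: "y \<in> carrier ?P"
  let ?S = "divisibility_layer p m n"
  have zero: "?S 0 = UNIV"
    by (auto simp: divisibility_layer_def)
  have "group ?P" by (intro DirProd_group) simp_all
  then have triv: "(\<lambda>_. \<one>\<^bsub>?P\<^esub>) \<in> hom ?P ?P"
    by (rule trivial_hom)
  show "\<exists>f \<in> hom ?P ?P. f x = y \<or> f y = x"
  proof (cases "x = \<one>\<^bsub>?P\<^esub>")
    case True
    with triv show ?thesis by (intro bexI[of _ "\<lambda>_. \<one>\<^bsub>?P\<^esub>"]) auto
  next
    case False
    \<comment> \<open>Whichever of \<open>x\<close> and \<open>y\<close> drops out of the chain at the smaller index is the source.\<close>
    define t where "t = (LEAST t. x \<notin> ?S t)"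
    have t: "x \<notin> ?S t" and below: "r < t \<Longrightarrow> x \<in> ?S r" for r
      using zero_or_outside_some_layer[OF p x] False LeastI_ex[of "\<lambda>t. x \<notin> ?S t"] not_less_Least
      unfolding t_def by blast+
    obtain s where s: "t = Suc s" using t zero by (cases t) auto
    show ?thesis
    proof (cases "y \<in> ?S s")
      case True
      then show ?thesis
        using endomorphism_into_layer[OF p _ y, of x s] t s by auto
    next
      case False
      define r where "r = (LEAST r. y \<notin> ?S r)"
      have r: "y \<notin> ?S r" "r \<le> s"
        using LeastI[of "\<lambda>t. y \<notin> ?S t"] False Least_le[of "\<lambda>t. y \<notin> ?S t" s] unfolding r_def by auto
      then obtain q where q: "r = Suc q" using zero by (cases r) auto
      then have "x \<in> ?S q" using below r(2) s by simp
      then show ?thesis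
        using endomorphism_into_layer[OF p _ x, of y q] r(1) q by auto
    qed
  qed
qed

section \<open>Splitting off a cyclic factor of maximal order\<close>

text \<open>Take \<open>K\<close> maximal among the subgroups meeting \<open>\<langle>x\<rangle>\<close> trivially.  If \<open>K\<langle>x\<rangle>\<close> were proper, there would be
\<open>f\<close> outside it with \<open>f\<^sup>p = y x\<^sup>i\<close> and \<open>y \<in> K\<close>.  Because \<open>x\<close> has maximal order, \<open>i\<close> is divisible by \<open>p\<close>,
so \<open>f\<close> can be corrected by a power of \<open>x\<close> to an element \<open>e\<close> with \<open>e\<^sup>p \<in> K\<close>; adjoining \<open>e\<close> to \<open>K\<close> then
contradicts maximality.\<close>

lemma (in comm_group) maximal_order_cyclic_complement:
  fixes p k :: nat
  assumes fin: "finite (carrier G)" and p: "Factorial_Ring.prime p"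
    and exponent: "\<And>g. g \<in> carrier G \<Longrightarrow> g [^] (p ^ k) = \<one>"
    and x: "x \<in> carrier G" "ord x = p ^ k"
  obtains K where "subgroup K G" "K \<inter> range (\<lambda>i::int. x [^] i) \<subseteq> {\<one>}"
    "K <#> range (\<lambda>i::int. x [^] i) = carrier G"
proof -
  define C where "C y = range (\<lambda>i::int. y [^] i)" for y
  have C: "subgroup (C y) G" if "y \<in> carrier G" for y
    unfolding C_def using that by (rule subgroup_of_powers)
  have P: "Factorial_Ring.prime (int p)" using p by simp
  define F where "F = {K. subgroup K G \<and> K \<inter> C x \<subseteq> {\<one>}}"
  have "F \<subseteq> Pow (carrier G)"
    unfolding F_def using subgroup.subset by auto
  then have "finite F" using fin by (auto intro: finite_subset)
  moreover have "{\<one>} \<in> F"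
    unfolding F_def by (auto simp: triv_subgroup)
  ultimately obtain K where KF: "K \<in> F" and maxi: "\<And>L. L \<in> F \<Longrightarrow> K \<subseteq> L \<Longrightarrow> K = L"
    using finite_has_maximal[of F] by blast
  then have K: "subgroup K G" and disj: "K \<inter> C x \<subseteq> {\<one>}" by (auto simp: F_def)
  interpret K: subgroup K G by fact
  define H where "H = K <#> C x"
  have Hsub: "subgroup H G" unfolding H_def using mult_subgroups[OF K C[OF x(1)]] .
  interpret H: subgroup H G by fact
  have Cx: "x [^] (i::int) \<in> C x" for i by (simp add: C_def)
  have KH: "h \<otimes> x [^] (i::int) \<in> H" if "h \<in> K" for h i
    using that Cx by (auto simp: H_def set_mult_def)
  have K_le_H: "h \<in> H" if "h \<in> K" for h
    using KH[OF that, of 0] that by simp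
  have C_le_H: "x [^] (i::int) \<in> H" for i
    using KH[OF K.one_closed, of i] x(1) by simp
  note powH = subgroup_int_pow_closed[OF Hsub] and powK = subgroup_int_pow_closed[OF K]
  have "g \<in> H" if g0: "g \<in> carrier G" for g
  proof (rule ccontr)
    assume "g \<notin> H"
    \<comment> \<open>The last \<open>p\<close>-power iterate of \<open>g\<close> outside \<open>H\<close> is an element whose \<open>p\<close>-th power is in \<open>H\<close>.\<close>
    define n where "n = (LEAST n. g [^] (p ^ n) \<in> H)"
    have "g [^] (p ^ k) \<in> H" using exponent[OF g0] by simp
    then have n: "g [^] (p ^ n) \<in> H" and least: "r < n \<Longrightarrow> g [^] (p ^ r) \<notin> H" for r
      using LeastI[of "\<lambda>n. g [^] (p ^ n) \<in> H"] not_less_Least[of r "\<lambda>n. g [^] (p ^ n) \<in> H"]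
      unfolding n_def by blast+
    obtain r where r: "n = Suc r" using n \<open>g \<notin> H\<close> g0 by (cases n) auto
    define f where "f = g [^] (p ^ r)"
    have f: "f \<in> carrier G" "f \<notin> H" "f [^] int p \<in> H"
      using g0 n least[of r] r by (auto simp: f_def int_pow_int nat_pow_pow mult.commute)
    then obtain y i where y: "y \<in> K" and fy: "f [^] int p = y \<otimes> x [^] (i::int)"
      by (auto simp: H_def set_mult_def C_def)
    have yc: "y \<in> carrier G" using y by simp
    have "k \<noteq> 0" using exponent[OF f(1)] f by (cases k) auto
    then obtain l where l: "k = Suc l" by (cases k) auto
    have "\<one> = (f [^] int p) [^] int (p ^ l)"
      using exponent[OF f(1)] f(1) by (simp add: int_pow_int nat_pow_pow l del: of_nat_power)
    also have "\<dots> = y [^] int (p ^ l) \<otimes> x [^] (i * int (p ^ l))"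
      unfolding fy using yc x(1) by (simp add: int_pow_mult_distrib m_comm int_pow_pow)
    finally have "x [^] (i * int (p ^ l)) = inv (y [^] int (p ^ l))"
      using yc x(1) by (metis int_pow_closed inv_equality inv_inv inv_closed)
    then have "x [^] (i * int (p ^ l)) \<in> K"
      using K.m_inv_closed[OF powK[OF y]] by simp
    then have "x [^] (i * int (p ^ l)) = \<one>" using disj Cx by auto
    then have "int (p ^ Suc l) dvd i * int (p ^ l)"
      using x int_pow_eq_id[OF x(1)] l by simp
    then have "int p dvd i" using prime_gt_0_nat[OF p] by simp
    then obtain j where j: "i = int p * j" by auto
    define e where "e = f \<otimes> x [^] (- j)"
    have e: "e \<in> carrier G" using f(1) x(1) by (simp add: e_def)
    have "e [^] int p = f [^] int p \<otimes> x [^] (- j * int p)"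
      unfolding e_def using f(1) x(1) by (simp add: int_pow_mult_distrib m_comm int_pow_pow)
    also have "\<dots> = y \<otimes> (x [^] i \<otimes> x [^] (- j * int p))"
      unfolding fy using yc x(1) by (simp add: m_assoc)
    also have "x [^] i \<otimes> x [^] (- j * int p) = x [^] (0::int)"
      using x(1) by (simp add: j int_pow_mult[symmetric] mult.commute)
    finally have ep: "e [^] int p = y" using yc by simp
    have "e \<notin> H"
    proof
      assume "e \<in> H"
      then have "e \<otimes> x [^] j \<in> H" using C_le_H by simp
      moreover have "e \<otimes> x [^] j = f"
        using f(1) x(1) by (simp add: e_def m_assoc int_pow_mult[symmetric])
      ultimately show False using f(2) by simp
    qed
    have sub: "subgroup (K <#> C e) G" by (rule mult_subgroups[OF K C[OF e]])
    have "z = \<one>" if z: "z \<in> K <#> C e" "z \<in> C x" for z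
    proof -
      obtain h s where h: "h \<in> K" and zh: "z = h \<otimes> e [^] (s::int)"
        using z(1) by (auto simp: set_mult_def C_def)
      have es: "e [^] s = inv h \<otimes> z"
        using h e by (simp add: zh m_assoc[symmetric])
      have "z \<in> H" using z(2) C_le_H by (auto simp: C_def)
      then have esH: "e [^] s \<in> H"
        unfolding es using K_le_H[OF K.m_inv_closed[OF h]] by simp
      \<comment> \<open>Otherwise \<open>e\<close> itself is a combination of \<open>e\<^sup>s\<close> and \<open>e\<^sup>p\<close>, which are both in \<open>H\<close>.\<close>
      have "int p dvd s"
      proof (rule ccontr)
        assume "\<not> int p dvd s"
        then have "coprime (int p) s" using prime_imp_coprime[OF P] by simp
        then obtain \<alpha> \<beta> where "\<alpha> * int p + \<beta> * s = 1"
          using bezout_int[of "int p" s] by (metis coprime_imp_gcd_eq_1)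
        then have "e = e [^] (int p * \<alpha> + s * \<beta>)"
          using e by (simp add: mult.commute)
        also have "\<dots> = (e [^] int p) [^] \<alpha> \<otimes> (e [^] s) [^] \<beta>"
          using e by (simp add: int_pow_mult int_pow_pow)
        also have "\<dots> \<in> H"
          using powH esH K_le_H[OF y] by (simp add: ep)
        finally show False using \<open>e \<notin> H\<close> by simp
      qed
      then obtain r where "s = int p * r" by auto
      then have "e [^] s = y [^] r" using e by (simp add: int_pow_pow ep[symmetric])
      then have "z \<in> K" unfolding zh using powK[OF y] h by simp
      then show "z = \<one>" using disj z(2) by auto
    qed
    then have "K <#> C e \<in> F" using sub by (auto simp: F_def)
    moreover have "K \<subseteq> K <#> C e"
    proof
      fix h assume h: "h \<in> K"
      moreover have "e [^] (0::int) \<in> C e" unfolding C_def by blast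
      ultimately have "h \<otimes> e [^] (0::int) \<in> K <#> C e" unfolding set_mult_def by blast
      then show "h \<in> K <#> C e" using h by simp
    qed
    ultimately have "K = K <#> C e" by (rule maxi)
    moreover have "e \<in> K <#> C e"
    proof -
      have "e [^] (1::int) \<in> C e" unfolding C_def by blast
      then have "\<one> \<otimes> e [^] (1::int) \<in> K <#> C e"
        using K.one_closed unfolding set_mult_def by blast
      then show ?thesis using e by simp
    qed
    ultimately show False using \<open>e \<notin> H\<close> K_le_H by blast
  qed
  then have "H = carrier G" using H.subset by blast
  then show thesis using that[OF K] disj by (simp add: H_def C_def)
qed

lemma (in comm_group) internal_cyclic_product_iso:
  assumes x: "x \<in> carrier G" "ord x = q" "q > 0"
    and K: "subgroup K G" "K \<inter> range (\<lambda>i::int. x [^] i) \<subseteq> {\<one>}"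
      "K <#> range (\<lambda>i::int. x [^] i) = carrier G"
  shows "G \<cong> integer_mod_group q \<times>\<times> G\<lparr>carrier := K\<rparr>"
proof -
  interpret K: subgroup K G by fact
  have modq: "x [^] (i mod int q) = x [^] i" for i :: int
    using x by (simp add: int_pow_eq minus_mod_eq_mult_div)
  let ?P = "integer_mod_group q \<times>\<times> G\<lparr>carrier := K\<rparr>"
  let ?f = "\<lambda>(i::int, h). x [^] i \<otimes> h"
  have gP: "group ?P"
    using K(1) by (intro DirProd_group) (simp_all add: subgroup.subgroup_is_group)
  have hom: "?f \<in> hom ?P G"
  proof (rule homI)
    fix z w assume "z \<in> carrier ?P" "w \<in> carrier ?P"
    then show "?f (z \<otimes>\<^bsub>?P\<^esub> w) = ?f z \<otimes> ?f w"
      using x(1) by (auto simp: modq int_pow_mult m_ac)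
  qed (use x(1) in auto)
  interpret f: group_hom ?P G ?f
    using gP hom by (simp add: group_hom_def group_hom_axioms_def)
  have "?f \<in> iso ?P G"
    unfolding f.iso_iff
  proof (intro conjI ballI subsetI impI)
    fix g assume "g \<in> carrier G"
    then obtain h i where hi: "h \<in> K" "g = h \<otimes> x [^] (i::int)"
      unfolding K(3)[symmetric] by (auto simp: set_mult_def)
    then have "g = ?f (i mod int q, h)" "(i mod int q, h) \<in> carrier ?P"
      using x by (auto simp: modq m_comm carrier_integer_mod_group)
    then show "g \<in> ?f ` carrier ?P" by blast
  next
    fix z assume z: "z \<in> carrier ?P" "?f z = \<one>"
    then obtain i h where ih: "z = (i, h)" "i \<in> {0..<int q}" "h \<in> K" "x [^] i \<otimes> h = \<one>"
      using x(3) by (auto simp: carrier_integer_mod_group)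
    then have xi: "x [^] i = inv h" using x(1) by (simp add: inv_equality)
    then have "x [^] i \<in> K \<inter> range (\<lambda>i::int. x [^] i)"
      using K.m_inv_closed[OF ih(3)] by (metis IntI rangeI)
    then have x1: "x [^] i = \<one>" using K(2) by blast
    then have "int q dvd i" using x int_pow_eq_id by blast
    then have "i = 0" using ih(2) by (metis atLeastLessThan_iff dvd_imp_mod_0 mod_pos_pos_trivial)
    moreover have "h = \<one>" using ih(3,4) x1 by simp
    ultimately show "z = \<one>\<^bsub>?P\<^esub>" by (simp add: ih(1))
  qed
  then show ?thesis
    using group.iso_sym[OF gP] is_isoI by blast
qed

section \<open>Decomposition into cyclic groups of two adjacent exponents\<close>

lemma cyclic_power_Suc_iso:
  "integer_mod_group q \<times>\<times> cyclic_power q m \<cong> cyclic_power q (Suc m)"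
proof -
  let ?P = "integer_mod_group q \<times>\<times> cyclic_power q m"
  let ?f = "\<lambda>z. \<lambda>i\<in>{..<Suc m}. if i = m then fst z else snd z i"
  have "(\<lambda>z. if i = m then fst z else snd z i) \<in> hom ?P (integer_mod_group q)" if "i < Suc m" for i
  proof (cases "i = m")
    case False
    with that have "i < m" by simp
    then show ?thesis
      using Group.hom_compose[OF snd_hom hom_product_group_component[of i "{..<m}"]] False
      by (simp add: o_def)
  qed (simp add: fst_hom)
  then have hom: "?f \<in> hom ?P (cyclic_power q (Suc m))"
    by (intro hom_into_product_group) simp
  have "bij_betw ?f (carrier ?P) (carrier (cyclic_power q (Suc m)))"
  proof (rule bij_betw_byWitness[where f' = "\<lambda>u. (u m, restrict u {..<m})"])
    show "\<forall>z \<in> carrier ?P. (?f z m, restrict (?f z) {..<m}) = z"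
    proof
      fix z assume "z \<in> carrier ?P"
      then have ext: "snd z \<in> extensional {..<m}"
        by (simp add: DirProd_def PiE_def mem_Times_iff)
      have "restrict (?f z) {..<m} = snd z"
        by (rule extensionalityI[OF restrict_extensional ext]) simp
      then show "(?f z m, restrict (?f z) {..<m}) = z"
        by (simp add: prod_eq_iff)
    qed
    show "\<forall>u \<in> carrier (cyclic_power q (Suc m)). ?f (u m, restrict u {..<m}) = u"
    proof
      fix u assume "u \<in> carrier (cyclic_power q (Suc m))"
      then have ext: "u \<in> extensional {..<Suc m}"
        by (simp add: PiE_def)
      show "?f (u m, restrict u {..<m}) = u"
        by (rule extensionalityI[OF restrict_extensional ext]) auto
    qed
    show "?f ` carrier ?P \<subseteq> carrier (cyclic_power q (Suc m))"
      using hom by (rule hom_carrier)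
    show "(\<lambda>u. (u m, restrict u {..<m})) ` carrier (cyclic_power q (Suc m)) \<subseteq> carrier ?P"
    proof clarify
      fix u assume "u \<in> carrier (cyclic_power q (Suc m))"
      then have "u i \<in> carrier (integer_mod_group q)" if "i < Suc m" for i
        using that by (simp add: PiE_iff)
      then show "(u m, restrict u {..<m}) \<in> carrier ?P"
        by (simp add: PiE_def)
    qed
  qed
  with hom show ?thesis by (intro is_isoI[OF isoI])
qed

lemma DirProd_assoc_iso: "(G \<times>\<times> H) \<times>\<times> I \<cong> G \<times>\<times> (H \<times>\<times> I)"
proof (rule is_isoI)
  show "(\<lambda>((x, y), z). (x, (y, z))) \<in> iso ((G \<times>\<times> H) \<times>\<times> I) (G \<times>\<times> (H \<times>\<times> I))"
    by (auto simp: iso_def hom_def inj_on_def bij_betw_def image_iff)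
qed

lemma two_exponents_absorb_cyclic:
  assumes "q = p ^ a \<or> q = p ^ (a + 1)"
  obtains m' n' where "integer_mod_group q \<times>\<times>
      (cyclic_power (p ^ a) m \<times>\<times> cyclic_power (p ^ (a + 1)) n)
    \<cong> cyclic_power (p ^ a) m' \<times>\<times> cyclic_power (p ^ (a + 1)) n'"
proof -
  let ?A = "cyclic_power (p ^ a)" and ?B = "cyclic_power (p ^ (a + 1))" and ?Z = "integer_mod_group q"
  have gr: "group (cyclic_power c k)" for c k by simp
  have grp: "group (?Z \<times>\<times> ?A i)" for i
    by (intro DirProd_group gr group_integer_mod_group)
  from assms show thesis
  proof
    assume q: "q = p ^ a"
    have "?Z \<times>\<times> (?A m \<times>\<times> ?B n) \<cong> (?Z \<times>\<times> ?A m) \<times>\<times> ?B n"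
      by (rule group.iso_sym[OF DirProd_group[OF grp gr] DirProd_assoc_iso])
    also have "\<dots> \<cong> ?A (Suc m) \<times>\<times> ?B n"
      using cyclic_power_Suc_iso[of q m] q
      by (intro group.DirProd_iso_trans grp iso_refl) simp
    finally show thesis by (rule that)
  next
    assume q: "q = p ^ (a + 1)"
    have "?Z \<times>\<times> (?A m \<times>\<times> ?B n) \<cong> (?A m \<times>\<times> ?B n) \<times>\<times> ?Z"
      by (rule DirProd_commute_iso)
    also have "\<dots> \<cong> ?A m \<times>\<times> (?B n \<times>\<times> ?Z)"
      by (rule DirProd_assoc_iso)
    also have "\<dots> \<cong> ?A m \<times>\<times> (?Z \<times>\<times> ?B n)"
      by (intro group.DirProd_iso_trans gr iso_refl DirProd_commute_iso)
    also have "\<dots> \<cong> ?A m \<times>\<times> ?B (Suc n)"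
      using cyclic_power_Suc_iso[of q n] q
      by (intro group.DirProd_iso_trans gr iso_refl) simp
    finally show thesis by (rule that)
  qed
qed

text \<open>Taking \<open>p\<close>-th roots \<open>k\<close> times writes every element as a \<open>p\<^sup>k\<close>-th power.\<close>

lemma (in group) trivial_if_all_elements_are_pth_powers:
  fixes p a k :: nat
  assumes root: "\<And>y. y \<in> carrier G \<Longrightarrow> \<exists>g \<in> carrier G. y = g [^] p"
    and exponent: "\<And>g. g \<in> carrier G \<Longrightarrow> g [^] (p ^ k) = \<one>"
  shows "carrier G = {\<one>}"
proof -
  have "\<forall>y \<in> carrier G. \<exists>g \<in> carrier G. y = g [^] (p ^ j)" for j
  proof (induction j)
    case (Suc j)
    show ?case
    proof
      fix y assume "y \<in> carrier G"
      then obtain h where h: "h \<in> carrier G" "y = h [^] (p ^ j)" using Suc by blast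
      then obtain g where "g \<in> carrier G" "h = g [^] p" using root by blast
      with h show "\<exists>g \<in> carrier G. y = g [^] (p ^ Suc j)"
        by (auto simp: nat_pow_pow)
    qed
  qed (auto intro!: bexI)
  then have "y = \<one>" if "y \<in> carrier G" for y
    using exponent that by metis
  then show ?thesis by auto
qed

text \<open>The second condition bounds the exponents from below: a generator of a nontrivial cyclic direct factor
is not a \<open>p\<close>-th power, so its order is at least \<open>p\<^sup>a\<close>.  The exponent of \<open>G\<close> itself cannot be smaller than
\<open>p\<^sup>a\<close> for nontrivial \<open>G\<close>, since then every element would be a \<open>p\<close>-th power, which forces a \<open>p\<close>-group to be trivial; hence the factor of maximal
order that is split off is of one of the two allowed sizes.  Both conditions are inherited by its
complement.\<close>

lemma two_exponents_decomposition:
  fixes G :: "('a, 'b) monoid_scheme" and p a :: nat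
  assumes "comm_group G" "finite (carrier G)" and p: "Factorial_Ring.prime p" and a: "1 \<le> a"
    and "\<And>g. g \<in> carrier G \<Longrightarrow> g [^]\<^bsub>G\<^esub> (p ^ (a + 1)) = \<one>\<^bsub>G\<^esub>"
    and "\<And>y. y \<in> carrier G \<Longrightarrow> y [^]\<^bsub>G\<^esub> (p ^ (a - 1)) = \<one>\<^bsub>G\<^esub> \<Longrightarrow>
      \<exists>g \<in> carrier G. y = g [^]\<^bsub>G\<^esub> p"
  shows "\<exists>m n. G \<cong> cyclic_power (p ^ a) m \<times>\<times> cyclic_power (p ^ (a + 1)) n"
  using assms(1,2,5,6)
proof (induction "card (carrier G)" arbitrary: G rule: less_induct)
  case less
  interpret comm_group G by fact
  note exponent = less.prems(3) and root = less.prems(4)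
  show ?case
  proof (cases "carrier G = {\<one>\<^bsub>G\<^esub>}")
    case True
    let ?P = "cyclic_power (p ^ a) 0 \<times>\<times> cyclic_power (p ^ (a + 1)) 0"
    have "group ?P" by (intro DirProd_group) simp_all
    moreover have "carrier ?P = {\<one>\<^bsub>?P\<^esub>}" by auto
    ultimately have "(\<lambda>_. \<one>\<^bsub>?P\<^esub>) \<in> iso G ?P"
      using True by (intro isoI trivial_hom) (simp_all add: bij_betw_def)
    then have "G \<cong> ?P" by (rule is_isoI)
    then show ?thesis by blast
  next
    case False
    define E where "E k \<longleftrightarrow> (\<forall>g \<in> carrier G. g [^]\<^bsub>G\<^esub> (p ^ k) = \<one>\<^bsub>G\<^esub>)" for k
    define k where "k = (LEAST k. E k)"
    have E: "E (a + 1)" using exponent unfolding E_def by (rule ballI)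
    have "E k" unfolding k_def using E by (rule LeastI)
    then have k: "g [^]\<^bsub>G\<^esub> (p ^ k) = \<one>\<^bsub>G\<^esub>" if "g \<in> carrier G" for g
      unfolding E_def using that by (rule bspec)
    have "k \<le> a + 1"
      unfolding k_def using E by (rule Least_le)
    moreover have "a \<le> k"
    proof (rule ccontr)
      assume "\<not> a \<le> k"
      then have "p ^ k dvd p ^ (a - 1)" by (intro le_imp_power_dvd) simp
      then have "g [^]\<^bsub>G\<^esub> (p ^ (a - 1)) = \<one>\<^bsub>G\<^esub>" if "g \<in> carrier G" for g
        using k[OF that] that by (metis pow_eq_id dvd_trans)
      then have "carrier G = {\<one>\<^bsub>G\<^esub>}"
        by (intro trivial_if_all_elements_are_pth_powers[OF _ k] root)
      with False show False by blast
    qed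
    ultimately have ka: "p ^ k = p ^ a \<or> p ^ k = p ^ (a + 1)"
      by (metis Suc_eq_plus1 antisym le_SucE)
    obtain k' where k': "k = Suc k'" using a \<open>a \<le> k\<close> by (cases k) auto
    then have "\<not> E k'"
      using not_less_Least[of k' E] unfolding k_def by simp
    then obtain x where x: "x \<in> carrier G" "x [^]\<^bsub>G\<^esub> (p ^ k') \<noteq> \<one>\<^bsub>G\<^esub>"
      unfolding E_def by (meson that)
    obtain j where j: "j \<le> k" "ord x = p ^ j"
      using k[OF x(1)] pow_eq_id[OF x(1)] divides_primepow_nat[OF p] by blast
    have "\<not> j \<le> k'"
      using x pow_eq_id[OF x(1)] j(2) le_imp_power_dvd by metis
    then have ordx: "ord x = p ^ k" using j k' by (metis le_SucE)
    obtain K where K: "subgroup K G" "K \<inter> range (\<lambda>i::int. x [^]\<^bsub>G\<^esub> i) \<subseteq> {\<one>\<^bsub>G\<^esub>}"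
      "K <#>\<^bsub>G\<^esub> range (\<lambda>i::int. x [^]\<^bsub>G\<^esub> i) = carrier G"
      using maximal_order_cyclic_complement[OF less.prems(2) p k x(1) ordx] by blast
    interpret K: subgroup K G by fact
    let ?K = "G\<lparr>carrier := K\<rparr>"
    \<comment> \<open>The complement is a proper subgroup because it misses \<open>x\<close>, so the induction hypothesis applies.\<close>
    have x1: "x \<noteq> \<one>\<^bsub>G\<^esub>" using x(2) by auto
    have "x [^]\<^bsub>G\<^esub> (1::int) \<in> range (\<lambda>i::int. x [^]\<^bsub>G\<^esub> i)" by (rule rangeI)
    then have "x \<notin> K" using K(2) x1 x(1) by auto
    then have "K \<subset> carrier G" using K.subset x(1) by blast
    then have "card (carrier ?K) < card (carrier G)"
      using less.prems(2) by (simp add: psubset_card_mono)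
    moreover have "comm_group ?K"
      using subgroup.subgroup_is_group[OF K(1) is_group]
      by (rule group.group_comm_groupI) (simp add: m_comm)
    moreover have "finite (carrier ?K)"
      using K.subset less.prems(2) finite_subset by auto
    moreover have "g [^]\<^bsub>?K\<^esub> (p ^ (a + 1)) = \<one>\<^bsub>?K\<^esub>" if "g \<in> carrier ?K" for g
      using exponent[of g] that by (simp add: nat_pow_consistent[symmetric])
    moreover have "\<exists>g \<in> carrier ?K. y = g [^]\<^bsub>?K\<^esub> p"
      if y: "y \<in> carrier ?K" "y [^]\<^bsub>?K\<^esub> (p ^ (a - 1)) = \<one>\<^bsub>?K\<^esub>" for y
    proof -
      have yK: "y \<in> K" using y(1) by simp
      have "y [^]\<^bsub>G\<^esub> (p ^ (a - 1)) = \<one>\<^bsub>G\<^esub>"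
        using y(2) by (simp add: nat_pow_consistent[symmetric])
      \<comment> \<open>A \<open>p\<close>-th root of \<open>y\<close> in \<open>G\<close> is replaced by its component in \<open>K\<close>.\<close>
      then obtain g where g: "g \<in> carrier G" "y = g [^]\<^bsub>G\<^esub> p"
        using root[of y] yK by auto
      obtain h i where h: "h \<in> K" "g = h \<otimes>\<^bsub>G\<^esub> x [^]\<^bsub>G\<^esub> (i::int)"
        using g(1) unfolding K(3)[symmetric] by (auto simp: set_mult_def)
      have hp: "h [^]\<^bsub>G\<^esub> p \<in> K"
        using h(1) by (induction p) auto
      have "y = h [^]\<^bsub>G\<^esub> p \<otimes>\<^bsub>G\<^esub> (x [^]\<^bsub>G\<^esub> i) [^]\<^bsub>G\<^esub> p"
        unfolding g(2) h(2) using h(1) x(1) by (simp add: pow_mult_distrib m_comm)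
      also have "(x [^]\<^bsub>G\<^esub> i) [^]\<^bsub>G\<^esub> p = x [^]\<^bsub>G\<^esub> (i * int p)"
        using x(1) by (simp add: int_pow_pow int_pow_int[symmetric])
      finally have yh: "y = h [^]\<^bsub>G\<^esub> p \<otimes>\<^bsub>G\<^esub> x [^]\<^bsub>G\<^esub> (i * int p)" .
      then have "x [^]\<^bsub>G\<^esub> (i * int p) = inv\<^bsub>G\<^esub> (h [^]\<^bsub>G\<^esub> p) \<otimes>\<^bsub>G\<^esub> y"
        using hp x(1) by (simp add: m_assoc[symmetric])
      then have "x [^]\<^bsub>G\<^esub> (i * int p) \<in> K" using hp yK by simp
      then have "x [^]\<^bsub>G\<^esub> (i * int p) = \<one>\<^bsub>G\<^esub>" using K(2) by blast
      then have "y = h [^]\<^bsub>G\<^esub> p" using yh hp by simp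
      then show ?thesis
        using h(1) by (auto simp: nat_pow_consistent[symmetric])
    qed
    ultimately obtain m n where mn: "?K \<cong> cyclic_power (p ^ a) m \<times>\<times> cyclic_power (p ^ (a + 1)) n"
      using less.hyps by meson
    obtain m' n' where mn': "integer_mod_group (p ^ k) \<times>\<times>
        (cyclic_power (p ^ a) m \<times>\<times> cyclic_power (p ^ (a + 1)) n)
        \<cong> cyclic_power (p ^ a) m' \<times>\<times> cyclic_power (p ^ (a + 1)) n'"
      using two_exponents_absorb_cyclic[OF ka] .
    have "G \<cong> integer_mod_group (p ^ k) \<times>\<times> ?K"
      using internal_cyclic_product_iso[OF x(1) ordx _ K] prime_gt_0_nat[OF p] by simp
    also have "\<dots> \<cong> integer_mod_group (p ^ k) \<times>\<times>
        (cyclic_power (p ^ a) m \<times>\<times> cyclic_power (p ^ (a + 1)) n)"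
      by (rule group.DirProd_iso_trans[OF group_integer_mod_group iso_refl mn])
    also note mn'
    finally show ?thesis by blast
  qed
qed

section \<open>Groups with total endomorphism preorder\<close>

lemma hom_nat_pow_eq_one:
  assumes "group G" "f \<in> hom G G" "x \<in> carrier G" "x [^]\<^bsub>G\<^esub> (n::nat) = \<one>\<^bsub>G\<^esub>"
  shows "f x [^]\<^bsub>G\<^esub> n = \<one>\<^bsub>G\<^esub>"
  using assms hom_nat_pow[of f G G x n] hom_one[of f G G] by simp

text \<open>Fix an element \<open>x\<close> of prime order \<open>p\<close> and write the group order as \<open>p\<^sup>N m\<close> with \<open>m\<close> prime to \<open>p\<close>.  The
element \<open>h\<close> raised to the power \<open>p\<^sup>N\<close> has order dividing \<open>m\<close>, and orders can only shrink to divisors under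
endomorphisms, so comparability with \<open>x\<close> leaves only the identity.\<close>

lemma (in comm_group) endomorphism_chain_imp_prime_power_exponent:
  assumes fin: "finite (carrier G)" and nontriv: "carrier G \<noteq> {\<one>}" and chain: "endomorphism_chain G"
  obtains p N :: nat where "Factorial_Ring.prime p" "\<And>g. g \<in> carrier G \<Longrightarrow> g [^] (p ^ N) = \<one>"
proof -
  obtain g where g: "g \<in> carrier G" "g \<noteq> \<one>" using nontriv by blast
  then have "ord g \<noteq> 1" using ord_eq_1 by blast
  then obtain p where p: "Factorial_Ring.prime p" "p dvd ord g" using prime_factor_nat by blast
  then obtain r where r: "ord g = p * r" by auto
  have r0: "r > 0" using ord_ge_1[OF fin g(1)] r by (cases r) auto
  define x where "x = g [^] r"
  have x: "x \<in> carrier G" "x [^] p = \<one>"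
    using g(1) pow_ord_eq_1[OF g(1)] r by (simp_all add: x_def nat_pow_pow mult.commute)
  have x1: "x \<noteq> \<one>"
  proof
    assume "x = \<one>"
    then have "p * r dvd r" using pow_eq_id[OF g(1)] r by (simp add: x_def)
    then have "p * r \<le> r" using r0 by (simp add: dvd_imp_le)
    then show False using r0 prime_gt_1_nat[OF p(1)] by simp
  qed
  have "order G \<noteq> 0" using fin order_gt_0_iff_finite by simp
  moreover have "\<not> is_unit p" using p(1) not_prime_unit by blast
  ultimately obtain m where m: "order G = p ^ multiplicity p (order G) * m" "\<not> p dvd m"
    using multiplicity_decompose' by blast
  define N where "N = multiplicity p (order G)"
  have cop: "coprime p m" using p(1) m(2) by (rule prime_imp_coprime)
  have common: "z = \<one>" if "z \<in> carrier G" "z [^] p = \<one>" "z [^] m = \<one>" for z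
    using that cop pow_eq_id[OF that(1)] ord_eq_1[OF that(1)] by (metis coprime_common_divisor_nat)
  have "h [^] (p ^ N) = \<one>" if h: "h \<in> carrier G" for h
  proof -
    define y where "y = h [^] (p ^ N)"
    have y: "y \<in> carrier G" "y [^] m = \<one>"
      using h pow_order_eq_1[OF h] m(1) by (simp_all add: y_def N_def nat_pow_pow)
    obtain f where f: "f \<in> hom G G" "f x = y \<or> f y = x"
      using chain x(1) y(1) unfolding endomorphism_chain_def by blast
    from f(2) have "y = \<one>"
    proof
      assume "f x = y"
      then show ?thesis using hom_nat_pow_eq_one[OF is_group f(1) x] common y by metis
    next
      assume "f y = x"
      then show ?thesis using hom_nat_pow_eq_one[OF is_group f(1) y] common x x1 by metis
    qed
    then show ?thesis by (simp add: y_def)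
  qed
  with p(1) show thesis by (rule that)
qed

text \<open>If \<open>x\<close> is not killed by \<open>p\<^sup>a\<close>, then \<open>x\<^sup>p\<close> is not killed by \<open>p\<^sup>a\<^sup>-\<^sup>1\<close>, so it is no endomorphic image of \<open>y\<close>;
being comparable, \<open>y\<close> is an image of \<open>x\<^sup>p\<close>.  For \<open>a = 1\<close> the condition on \<open>y\<close> says that \<open>y\<close> is the
identity, which covers groups of exponent at most \<open>p\<close>.\<close>

lemma (in comm_group) endomorphism_chain_imp_roots:
  fixes p a :: nat
  assumes chain: "endomorphism_chain G" and a: "1 \<le> a"
    and large: "a = 1 \<or> (\<exists>x \<in> carrier G. x [^] (p ^ a) \<noteq> \<one>)"
    and y: "y \<in> carrier G" "y [^] (p ^ (a - 1)) = \<one>"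
  shows "\<exists>g \<in> carrier G. y = g [^] p"
proof (cases "\<exists>x \<in> carrier G. x [^] (p ^ a) \<noteq> \<one>")
  case True
  then obtain x where x: "x \<in> carrier G" "x [^] (p ^ a) \<noteq> \<one>" by blast
  obtain a' where a': "a = Suc a'" using a by (cases a) auto
  define z where "z = x [^] p"
  have z: "z \<in> carrier G" "z [^] (p ^ (a - 1)) \<noteq> \<one>"
    using x by (simp_all add: z_def nat_pow_pow a')
  obtain f where f: "f \<in> hom G G" "f z = y \<or> f y = z"
    using chain z(1) y(1) unfolding endomorphism_chain_def by blast
  then have "f z = y" using hom_nat_pow_eq_one[OF is_group f(1) y] z(2) by metis
  moreover have "f z = f x [^] p"
    using f(1) x(1) by (simp add: z_def hom_nat_pow)
  ultimately show ?thesis using hom_in_carrier[OF f(1) x(1)] by auto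
next
  case False
  then have "y = \<one>" using large y by simp
  then show ?thesis by (intro bexI[of _ \<one>]) simp_all
qed

lemma endomorphism_chain_imp_two_exponents:
  assumes "comm_group G" and fin: "finite (carrier G)" and chain: "endomorphism_chain G"
  shows "\<exists>(p::nat) (a::nat) (m::nat) (n::nat). Factorial_Ring.prime p \<and> 1 \<le> a \<and>
      G \<cong> cyclic_power (p ^ a) m \<times>\<times> cyclic_power (p ^ (a + 1)) n"
proof -
  interpret comm_group G by fact
  obtain p N :: nat where p: "Factorial_Ring.prime p"
    and N: "\<And>g. g \<in> carrier G \<Longrightarrow> g [^]\<^bsub>G\<^esub> (p ^ N) = \<one>\<^bsub>G\<^esub>"
  proof (cases "carrier G = {\<one>\<^bsub>G\<^esub>}")
    case True
    then show ?thesis using that[OF two_is_prime_nat] by simp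
  next
    case False
    then show ?thesis using endomorphism_chain_imp_prime_power_exponent[OF fin _ chain] that by blast
  qed
  define E where "E k \<longleftrightarrow> (\<forall>g \<in> carrier G. g [^]\<^bsub>G\<^esub> (p ^ k) = \<one>\<^bsub>G\<^esub>)" for k
  define k where "k = (LEAST k. E k)"
  have "E N" using N unfolding E_def by (rule ballI)
  then have "E k" unfolding k_def by (rule LeastI)
  then have k: "g [^]\<^bsub>G\<^esub> (p ^ k) = \<one>\<^bsub>G\<^esub>" if "g \<in> carrier G" for g
    unfolding E_def using that by (rule bspec)
  \<comment> \<open>For exponent \<open>1\<close> or \<open>p\<close>, which cannot be \<open>p\<^sup>a\<^sup>+\<^sup>1\<close> with \<open>a \<ge> 1\<close>, the value \<open>a = 1\<close> serves.\<close>
  define a where "a = max 1 (k - 1)"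
  have a: "1 \<le> a" "k \<le> a + 1" by (auto simp: a_def)
  have "g [^]\<^bsub>G\<^esub> (p ^ (a + 1)) = \<one>\<^bsub>G\<^esub>" if "g \<in> carrier G" for g
    using k[OF that] pow_eq_id[OF that] le_imp_power_dvd[OF a(2), of p] dvd_trans by metis
  moreover have "a = 1 \<or> (\<exists>x \<in> carrier G. x [^]\<^bsub>G\<^esub> (p ^ a) \<noteq> \<one>\<^bsub>G\<^esub>)"
  proof (cases "a = 1")
    case False
    then have "a < k" by (auto simp: a_def)
    then have "\<not> E a" unfolding k_def by (rule not_less_Least)
    then show ?thesis unfolding E_def by simp
  qed simp
  ultimately have "\<exists>m n. G \<cong> cyclic_power (p ^ a) m \<times>\<times> cyclic_power (p ^ (a + 1)) n"
    using endomorphism_chain_imp_roots[OF chain a(1)]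
    by (intro two_exponents_decomposition[OF assms(1) fin p a(1)]) blast+
  with p a(1) show ?thesis by blast
qed

theorem theorem6p3:
  fixes G :: "('a, 'b) monoid_scheme"
  assumes "comm_group G" and "finite (carrier G)"
  shows "complete_graph (with_proj (endomorphism_graph G)) \<longleftrightarrow>
    (\<exists>(p::nat) (a::nat) (m::nat) (n::nat). Factorial_Ring.prime p \<and> 1 \<le> a \<and>
      G \<cong> cyclic_power (p ^ a) m \<times>\<times> cyclic_power (p ^ (a + 1)) n)"
proof -
  have "group G" using assms(1) by (simp add: comm_group_def)
  then show ?thesis
    unfolding complete_endomorphism_graph_iff[OF assms(2)]
    using endomorphism_chain_imp_two_exponents[OF assms] endomorphism_chain_iso
      endomorphism_chain_two_exponents by blast
qed

end
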